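(* Let $\varphi\in[0,\pi]$ and let $n\geq 2$ be an integer. If $p(z)\in P_n^+(\varphi)$, then $p'(z)\in P_{n-1}^+(\varphi)$. That is, if $p$ is a polynomial of degree $n$ with real non-negative coefficients all of whose complex zeros lie in the sector $S(\varphi)$, then its derivative $p'$ is a polynomial of degree $n-1$ with real non-negative coefficients all of whose complex zeros lie in $S(\varphi)$.
   Context: For a positive integer $n$, $P_n^+$ denotes the set of all algebraic polynomials (in one complex variable $z$) of degree $n$ with real and non-negative coefficients. For $\varphi\in[0,\pi]$, $S(\varphi)=\{z\in\mathbb{C} : |\arg(z)|\geq\varphi\}$, where $\arg(z)\in(-\pi,\pi]$ is the principal argument of $z\neq 0$, and the vertex $z=0$ is regarded as belonging to $S(\varphi)$ (so $S(\varphi)$ is a closed sector). $P_n^+(\varphi)$ denotes the set of all polynomials in $P_n^+$ all of whose zeros lie in $S(\varphi)$. *)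

theory Defs
  imports
    "HOL-Complex_Analysis.Complex_Analysis"
    "HOL-Computational_Algebra.Computational_Algebra"
begin

text \<open>
  Polynomials of degree exactly \<open>n\<close> with real non-negative coefficients. They are taken as
  polynomials over the complex numbers, so that their zeros are the complex ones.
\<close>

definition nonneg_polys :: "nat \<Rightarrow> complex poly set" where
  "nonneg_polys n = {p. degree p = n \<and> (\<forall>i. coeff p i \<in> \<real>\<^sub>\<ge>\<^sub>0)}"

text \<open>
  \<^const>\<open>Arg\<close> takes values in \<open>(-\<pi>, \<pi>]\<close>, with the junk value \<open>Arg 0 = 0\<close>; the vertex is therefore
  added explicitly.
\<close>

definition sector :: "real \<Rightarrow> complex set" where
  "sector \<phi> = {z. z = 0 \<or> \<bar>Arg z\<bar> \<ge> \<phi>}"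

definition nonneg_polys_sector :: "nat \<Rightarrow> real \<Rightarrow> complex poly set" where
  "nonneg_polys_sector n \<phi> = {p \<in> nonneg_polys n. \<forall>z. poly p z = 0 \<longrightarrow> z \<in> sector \<phi>}"

end

theory Submission
  imports Defs
begin

text \<open>
  Since \<open>p'\<close> has non-negative coefficients as well, it is positive on the positive axis, and its zeros
  come in conjugate pairs. It therefore suffices to exclude a zero \<open>z\<^sub>0 = r\<^sub>0 e\<^sup>i\<^sup>\<theta>\<close> of \<open>p'\<close> with
  \<open>0 < \<theta> < \<phi>\<close>. For \<open>\<phi> \<ge> \<pi>/2\<close> this is the Gauss-Lucas theorem; for smaller \<open>\<phi>\<close> the sector is not
  convex, and the sign of the coefficients becomes essential. The argument compares two counts of the
  zeros of one real polynomial.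

  Write \<open>p(z) = a\<^sub>l z\<^sup>l + \<dots> + a\<^sub>n z\<^sup>n\<close> with \<open>a\<^sub>l, a\<^sub>n > 0\<close>; the case \<open>l = n\<close> is trivial. For an angle \<open>\<xi>\<close>
  consider the function \<open>f(r) = Im (e\<^sup>-\<^sup>i\<^sup>\<xi> p(r e\<^sup>i\<^sup>\<theta>))\<close>, a polynomial in \<open>r\<close> with coefficients
  \<open>a\<^sub>k sin (k \<theta> - \<xi>)\<close>.

  The lower count: as \<open>p\<close> has no zeros in the sector between the positive axis and the ray of angle
  \<open>\<theta>\<close>, its continuous argument along this ray runs from \<open>l \<theta>\<close> to \<open>n \<theta>\<close>
  (\<open>continuous_argument_on_ray\<close>). By the intermediate value theorem it takes every level in \<open>\<xi> + \<pi>\<int>\<close>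
  strictly between these two values, and \<open>f\<close> vanishes at each of the corresponding radii.

  The upper count: the coefficients of \<open>f\<close> change their sign only where \<open>k \<theta>\<close> passes such a level. By
  Descartes' rule of signs, the number of positive zeros of \<open>f\<close> with multiplicity is at most the
  number of levels (\<open>descartes_sine_coefficients\<close>).

  The function \<open>f\<close> is not identically zero, because the argument also takes values that are not levels.
  Hence all positive zeros of \<open>f\<close> are simple. But if \<open>\<xi>\<close> is the argument of \<open>p(z\<^sub>0)\<close>, then \<open>f\<close> has a
  zero at \<open>r\<^sub>0\<close>, and \<open>p'(z\<^sub>0) = 0\<close> makes it a double one. This contradiction is
  \<open>pderiv_nonzero_on_ray\<close>.
\<close>

section \<open>Positive zeros of real polynomials\<close>

text \<open>
  Between neighbouring zeros of \<open>f\<close> Rolle's theorem gives a zero of \<open>f'\<close>. These lie strictly between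
  the points of \<open>S\<close>, so a multiple zero of \<open>f\<close> in \<open>S\<close> can later be counted as a further zero of
  \<open>f'\<close>; this is the purpose of the clause \<open>T \<inter> S = {}\<close>.
\<close>

lemma rolle_finite_zero_set:
  fixes f f' :: "real \<Rightarrow> real"
  assumes "finite S" and "S \<noteq> {}" and "S \<subseteq> {0<..}"
    and zero: "\<And>x. x \<in> S \<Longrightarrow> f x = 0"
    and deriv: "\<And>x. x > 0 \<Longrightarrow> (f has_real_derivative f' x) (at x)"
  shows "\<exists>T. finite T \<and> card S = Suc (card T) \<and> T \<inter> S = {} \<and> T \<subseteq> {0<..} \<and> (\<forall>t\<in>T. f' t = 0)"
proof -
  \<comment> \<open>For the induction, the new points are kept below \<open>Max S\<close>: adding a larger element \<open>b\<close> to \<open>S\<close>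
    then only calls for one more point between \<open>Max S\<close> and \<open>b\<close>.\<close>
  have "S \<noteq> {} \<longrightarrow> S \<subseteq> {0<..} \<longrightarrow> (\<forall>x\<in>S. f x = 0) \<longrightarrow>
    (\<exists>T. finite T \<and> card S = Suc (card T) \<and> T \<inter> S = {} \<and> T \<subseteq> {0<..<Max S} \<and> (\<forall>t\<in>T. f' t = 0))"
    using \<open>finite S\<close>
  proof (induction S rule: finite_linorder_max_induct)
    case empty
    then show ?case by simp
  next
    case (insert b A)
    show ?case
    proof (intro impI)
      assume pos: "insert b A \<subseteq> {0<..}" and zeros: "\<forall>x\<in>insert b A. f x = 0"
      show "\<exists>T. finite T \<and> card (insert b A) = Suc (card T) \<and> T \<inter> insert b A = {} \<and>
        T \<subseteq> {0<..<Max (insert b A)} \<and> (\<forall>t\<in>T. f' t = 0)"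
      proof (cases "A = {}")
        case True
        then show ?thesis by (intro exI[of _ "{}"]) auto
      next
        case False
        obtain T where T: "finite T" "card A = Suc (card T)" "T \<inter> A = {}"
          "T \<subseteq> {0<..<Max A}" "\<forall>t\<in>T. f' t = 0"
          using insert.IH False pos zeros by auto
        have MA: "Max A \<in> A" "Max A < b"
          using insert.hyps False by auto
        have ge: "x > 0" if "Max A \<le> x" for x
          using that MA(1) pos by force
        obtain t where t: "Max A < t" "t < b" "f' t = 0"
        proof -
          have "\<exists>z. Max A < z \<and> z < b \<and> (\<lambda>v. f' z * v) = (\<lambda>v. 0)"
          proof (rule Rolle_deriv[OF MA(2), where f = f])
            show "f (Max A) = f b" using MA(1) zeros by simp
            show "continuous_on {Max A..b} f"
              using deriv ge by (intro DERIV_continuous_on[of _ f f']) (meson atLeastAtMost_iff has_field_derivative_at_within)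
            show "(f has_derivative (\<lambda>v. f' x * v)) (at x)" if "Max A < x" for x
              using deriv ge that by (simp add: has_field_derivative_def)
          qed
          then show ?thesis using that by (metis mult.right_neutral)
        qed
        have "t \<notin> T" "t \<notin> A"
          using T(4) t(1) insert.hyps(1) by (force, meson Max_ge leD)
        moreover have "Max (insert b A) = b"
          using insert.hyps MA(2) False by (simp add: max_absorb1 less_imp_le)
        moreover have "b \<notin> A" "b \<notin> T"
          using insert.hyps T(4) MA(2) by auto
        ultimately show ?thesis
          using T t insert.hyps ge[of t] MA(2)
          by (intro exI[of _ "insert t T"]) auto
      qed
    qed
  qed
  then obtain T where "finite T" "card S = Suc (card T)" "T \<inter> S = {}" "T \<subseteq> {0<..<Max S}" "\<forall>t\<in>T. f' t = 0"
    using assms by auto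
  then show ?thesis by (intro exI[of _ T]) auto
qed

text \<open>
  The operator \<open>f \<mapsto> x f' - m f\<close> multiplies the coefficient of \<open>x\<^sup>k\<close> by \<open>k - m\<close>, hence removes a sign
  change located at \<open>m\<close>. It costs at most one positive zero, because it is, up to the factor
  \<open>x powr (m + 1)\<close>, the derivative of \<open>x powr (- m) * f\<close>, which has the same positive zeros as \<open>f\<close>.
\<close>

lemma euler_operator_zeros:
  fixes c :: "nat \<Rightarrow> real"
  assumes "finite S" and "S \<noteq> {}" and "S \<subseteq> {0<..}"
    and zero: "\<And>x. x \<in> S \<Longrightarrow> (\<Sum>k\<le>n. c k * x ^ k) = 0"
  shows "\<exists>T. finite T \<and> card S = Suc (card T) \<and> T \<inter> S = {} \<and> T \<subseteq> {0<..} \<and>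
           (\<forall>t\<in>T. (\<Sum>k\<le>n. c k * (real k - m) * t ^ k) = 0)"
proof -
  define f where "f x = (\<Sum>k\<le>n. c k * x powr (real k - m))" for x
  define f' where "f' x = (\<Sum>k\<le>n. c k * ((real k - m) * x powr (real k - m - 1)))" for x
  have "f x = 0" if "x \<in> S" for x
  proof -
    have "x > 0" using that assms(3) by auto
    then have "f x = (\<Sum>k\<le>n. c k * x ^ k) * x powr (- m)"
      unfolding f_def sum_distrib_right
      by (intro sum.cong refl) (simp add: powr_diff powr_realpow powr_minus field_simps)
    then show ?thesis using zero that by simp
  qed
  moreover have "(f has_real_derivative f' x) (at x)" if "x > 0" for x
    unfolding f_def f'_def by (intro DERIV_sum DERIV_cmult has_real_derivative_powr that)
  ultimately obtain T where T: "finite T" "card S = Suc (card T)" "T \<inter> S = {}" "T \<subseteq> {0<..}"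
      "\<And>t. t \<in> T \<Longrightarrow> f' t = 0"
    using rolle_finite_zero_set[of S f f'] assms(1-3) by blast
  have "(\<Sum>k\<le>n. c k * (real k - m) * t ^ k) = 0" if "t \<in> T" for t
  proof -
    have "t > 0" using that T(4) by auto
    then have "f' t = (\<Sum>k\<le>n. c k * (real k - m) * t ^ k) * t powr (- m - 1)"
      unfolding f'_def sum_distrib_right
      by (intro sum.cong refl) (simp add: powr_diff powr_realpow powr_minus powr_add field_simps)
    then show ?thesis using T(5)[OF that] \<open>t > 0\<close> by simp
  qed
  then show ?thesis using T by blast
qed

lemma euler_operators_root:
  fixes c :: "nat \<Rightarrow> real" and m :: "nat \<Rightarrow> real"
  assumes "finite S" and "card S > M" and "S \<subseteq> {0<..}"
    and "\<And>x. x \<in> S \<Longrightarrow> (\<Sum>k\<le>n. c k * x ^ k) = 0"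
  shows "\<exists>r>0. (\<Sum>k\<le>n. c k * (\<Prod>j<M. real k - m j) * r ^ k) = 0"
  using assms
proof (induction M arbitrary: c S)
  case 0
  then obtain r where "r \<in> S" by fastforce
  with 0 show ?case by (intro exI[of _ r]) auto
next
  case (Suc M)
  have "S \<noteq> {}" using Suc.prems by auto
  then obtain T where T: "finite T" "card S = Suc (card T)" "T \<subseteq> {0<..}"
     "\<forall>t\<in>T. (\<Sum>k\<le>n. c k * (real k - m M) * t ^ k) = 0"
    using euler_operator_zeros[where S = S and n = n and c = c and m = "m M"] Suc.prems by blast
  have "\<exists>r>0. (\<Sum>k\<le>n. c k * (real k - m M) * (\<Prod>j<M. real k - m j) * r ^ k) = 0"
    using Suc.IH[where S = T and c = "\<lambda>k. c k * (real k - m M)"] T Suc.prems(2) by auto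
  then show ?case by (simp add: mult_ac)
qed

text \<open>
  The linear factors vanish exactly at the sign changes of the sine inside the interval
  \<open>[-\<pi>, \<pi> M]\<close>, so the product keeps its sign there.
\<close>

lemma sin_times_linear_factors_sign:
  assumes "- pi \<le> t" and "t \<le> pi * real M"
  shows "(- 1) ^ Suc M * (sin t * (\<Prod>j<M. t - pi * real j)) \<ge> 0"
  using assms
proof (induction M)
  case 0
  then have "sin (- t) \<ge> 0" by (intro sin_ge_zero) auto
  then show ?case by simp
next
  case (Suc M)
  show ?case
  proof (cases "t \<le> pi * real M")
    case True
    then have "((- 1) ^ Suc M * (sin t * (\<Prod>j<M. t - pi * real j))) * (pi * real M - t) \<ge> 0"
      using Suc.IH[OF Suc.prems(1) True] True by (metis mult_nonneg_nonneg diff_ge_0_iff_ge)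
    then show ?thesis by (simp add: algebra_simps)
  next
    case False
    have "sin (t - real M * pi) \<ge> 0"
      using False Suc.prems by (intro sin_ge_zero) (auto simp: algebra_simps)
    then have "(- 1) ^ M * sin t \<ge> 0"
      by (simp add: sin_diff mult.commute)
    moreover have "(\<Prod>j<Suc M. t - pi * real j) \<ge> 0"
    proof (intro prod_nonneg ballI)
      fix j assume "j \<in> {..<Suc M}"
      then have "pi * real j \<le> pi * real M" by simp
      then show "0 \<le> t - pi * real j" using False by linarith
    qed
    ultimately have "((- 1) ^ M * sin t) * (\<Prod>j<Suc M. t - pi * real j) \<ge> 0"
      by (rule mult_nonneg_nonneg)
    then show ?thesis by (simp add: mult_ac)
  qed
qed

lemma nonneg_coeffs_positive_root:
  fixes c :: "nat \<Rightarrow> real"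
  assumes "\<And>k. k \<le> n \<Longrightarrow> c k \<ge> 0" and "r > 0" and "(\<Sum>k\<le>n. c k * r ^ k) = 0" and "k \<le> n"
  shows "c k = 0"
proof -
  have "c k * r ^ k = 0"
    using assms sum_nonneg_eq_0_iff[of "{..n}" "\<lambda>k. c k * r ^ k"] by auto
  then show ?thesis using assms(2) by simp
qed

text \<open>
  A form of Descartes' rule of signs. The sine changes its sign at the \<open>M\<close> points
  \<open>0, \<pi>, \<dots>, \<pi> (M - 1)\<close> inside the range of \<open>k \<theta> - \<xi>\<close>, so a nonzero polynomial with coefficients
  \<open>a k * sin (k \<theta> - \<xi>)\<close> has at most \<open>M\<close> positive zeros counted with multiplicity. Here there
  are at least \<open>M + 1\<close>: the set \<open>S\<close> accounts for \<open>M\<close>, and \<open>r\<^sub>0\<close> counts twice, since \<open>double\<close> says that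
  \<open>x f'\<close> vanishes there. The \<open>M\<close> Euler operators whose parameters are the
  positions of the sign changes leave a polynomial with coefficients of one sign that still has a
  positive zero, and this forces all coefficients to vanish.
\<close>

lemma descartes_sine_coefficients:
  fixes a :: "nat \<Rightarrow> real" and \<theta> \<xi> r\<^sub>0 :: real
  assumes nonneg: "\<And>k. k \<le> n \<Longrightarrow> a k \<ge> 0" and "\<theta> > 0"
    and range: "\<And>k. k \<le> n \<Longrightarrow> a k \<noteq> 0 \<Longrightarrow> real k * \<theta> - \<xi> \<in> {- pi .. pi * real M}"
    and S: "finite S" "card S \<ge> M" "S \<subseteq> {0<..}" "r\<^sub>0 \<in> S"
    and roots: "\<And>x. x \<in> S \<Longrightarrow> (\<Sum>k\<le>n. a k * sin (real k * \<theta> - \<xi>) * x ^ k) = 0"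
    and double: "(\<Sum>k\<le>n. real k * (a k * sin (real k * \<theta> - \<xi>)) * r\<^sub>0 ^ k) = 0"
    and "k \<le> n"
  shows "a k * sin (real k * \<theta> - \<xi>) = 0"
proof -
  define c where "c k = a k * sin (real k * \<theta> - \<xi>)" for k
  define m where "m j = (\<xi> + pi * real j) / \<theta>" for j
  obtain r where r: "r > 0" "(\<Sum>k\<le>n. c k * (\<Prod>j<M. real k - m j) * r ^ k) = 0"
  proof (cases M)
    case 0
    then show ?thesis using that[of r\<^sub>0] roots S by (auto simp: c_def)
  next
    case (Suc N)
    obtain T where T: "finite T" "card S = Suc (card T)" "T \<inter> S = {}" "T \<subseteq> {0<..}"
       "\<forall>t\<in>T. (\<Sum>k\<le>n. c k * (real k - m N) * t ^ k) = 0"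
      using euler_operator_zeros[where S = S and n = n and c = c and m = "m N"] S roots unfolding c_def by blast
    \<comment> \<open>The double root is a root of the image as well, and it is not among the points given by
      Rolle's theorem; the first operator therefore does not lower the number of roots.\<close>
    have "(\<Sum>k\<le>n. c k * (real k - m N) * r\<^sub>0 ^ k) =
        (\<Sum>k\<le>n. real k * c k * r\<^sub>0 ^ k) - m N * (\<Sum>k\<le>n. c k * r\<^sub>0 ^ k)"
      by (simp add: sum_distrib_left sum_subtractf[symmetric] algebra_simps)
    also have "\<dots> = 0" using double roots[OF S(4)] by (simp add: c_def)
    finally have "\<And>x. x \<in> insert r\<^sub>0 T \<Longrightarrow> (\<Sum>k\<le>n. c k * (real k - m N) * x ^ k) = 0"
      using T by auto
    moreover have "card (insert r\<^sub>0 T) > N"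
      using T S Suc by (subst card_insert_disjoint) auto
    moreover have "insert r\<^sub>0 T \<subseteq> {0<..}" "finite (insert r\<^sub>0 T)"
      using T S by auto
    ultimately obtain r where "r > 0"
        "(\<Sum>k\<le>n. c k * (real k - m N) * (\<Prod>j<N. real k - m j) * r ^ k) = 0"
      using euler_operators_root[where S = "insert r\<^sub>0 T" and M = N and n = n and c = "\<lambda>k. c k * (real k - m N)" and m = m] by blast
    then show ?thesis using that[of r] Suc by (simp add: mult_ac)
  qed
  define C where "C k = (- 1) ^ Suc M * (c k * (\<Prod>j<M. real k - m j))" for k
  have prod_eq: "(\<Prod>j<M. real k - m j) = (\<Prod>j<M. (real k * \<theta> - \<xi>) - pi * real j) / \<theta> ^ M" for k
  proof -
    have "real k - m j = ((real k * \<theta> - \<xi>) - pi * real j) / \<theta>" for j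
      using \<open>\<theta> > 0\<close> by (simp add: m_def field_simps)
    then show ?thesis by (simp add: prod_dividef)
  qed
  have C_nonneg: "C k \<ge> 0" if "k \<le> n" for k
  proof (cases "a k = 0")
    case True
    then show ?thesis by (simp add: C_def c_def)
  next
    case False
    let ?t = "real k * \<theta> - \<xi>"
    have "(- 1) ^ Suc M * (sin ?t * (\<Prod>j<M. ?t - pi * real j)) \<ge> 0"
      using range[OF that False] by (intro sin_times_linear_factors_sign) auto
    then have "a k / \<theta> ^ M * ((- 1) ^ Suc M * (sin ?t * (\<Prod>j<M. ?t - pi * real j))) \<ge> 0"
      using nonneg[OF that] \<open>\<theta> > 0\<close>
      by (metis mult_nonneg_nonneg divide_nonneg_pos zero_less_power)
    then show ?thesis unfolding C_def c_def prod_eq by (simp add: mult_ac)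
  qed
  have "(\<Sum>k\<le>n. C k * r ^ k) = (- 1) ^ Suc M * (\<Sum>k\<le>n. c k * (\<Prod>j<M. real k - m j) * r ^ k)"
    unfolding C_def sum_distrib_left by (simp add: mult_ac)
  then have "C k = 0"
    using nonneg_coeffs_positive_root[where n = n and c = C and r = r and k = k] C_nonneg r \<open>k \<le> n\<close> by simp
  then have "c k = 0 \<or> (\<exists>j<M. real k = m j)"
    unfolding C_def by auto
  \<comment> \<open>An operator can kill a coefficient only at an integer position, where the sine is zero anyway.\<close>
  moreover have "sin (real k * \<theta> - \<xi>) = 0" if "real k = m j" for j
  proof -
    have "real k * \<theta> - \<xi> = real j * pi"
      using that \<open>\<theta> > 0\<close> by (simp add: m_def field_simps)
    then show ?thesis by simp
  qed
  ultimately show ?thesis by (auto simp: c_def)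
qed

section \<open>The argument of a polynomial along a ray\<close>

text \<open>
  With \<open>z = e\<^sup>w\<close>, the quotient \<open>z p'(z) / p(z)\<close> is the derivative of \<open>log p (e\<^sup>w)\<close>; its limits at infinity
  and at the origin give the total change of argument of \<open>p\<close> along a ray.
\<close>

lemma log_derivative_tendsto_degree:
  fixes p :: "complex poly"
  assumes "p \<noteq> 0"
  shows "((\<lambda>z. z * poly (pderiv p) z / poly p z) \<longlongrightarrow> of_nat (degree p)) at_infinity"
proof (cases "degree p = 0")
  case True
  then have "pderiv p = 0" by (simp add: pderiv_eq_0_iff)
  then show ?thesis using True by simp
next
  case False
  define q where "q = pCons 0 (pderiv p) - smult (of_nat (degree p)) p"
  have "degree q < degree p"
  proof -
    have "degree q \<le> degree p"
      unfolding q_def using False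
      by (intro degree_diff_le) (auto simp: degree_pCons_eq_if degree_pderiv)
    moreover have "coeff q (degree p) = 0"
      using False by (cases "degree p") (auto simp: q_def coeff_pderiv)
    ultimately have "q = 0 \<or> degree q < degree p" by (rule eq_zero_or_degree_less)
    then show ?thesis using False by auto
  qed
  have "((\<lambda>z. poly q z / poly p z + of_nat (degree p)) \<longlongrightarrow> 0 + of_nat (degree p)) at_infinity"
    by (intro tendsto_add poly_divide_tendsto_0_at_infinity tendsto_const) fact
  moreover have "eventually (\<lambda>z. poly p z \<noteq> 0) at_infinity"
    using filterlim_poly_at_infinity[of p] False
    by (intro filterlim_at_infinity_imp_eventually_ne) auto
  then have "eventually (\<lambda>z. poly q z / poly p z + of_nat (degree p) = z * poly (pderiv p) z / poly p z) at_infinity"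
    by eventually_elim (simp add: q_def field_simps)
  ultimately show ?thesis by (simp add: tendsto_cong)
qed

lemma log_derivative_tendsto_order:
  fixes p :: "complex poly"
  assumes "p \<noteq> 0"
  shows "((\<lambda>z. z * poly (pderiv p) z / poly p z) \<longlongrightarrow> of_nat (order 0 p)) (at 0)"
proof -
  define l where "l = order 0 p"
  obtain q where q: "p = [:- 0, 1:] ^ l * q" "\<not> [:- 0, 1:] dvd q"
    using order_decomp[OF assms, of 0] by (auto simp: l_def)
  have q0: "poly q 0 \<noteq> 0" using q(2) by (simp add: poly_eq_0_iff_dvd)
  have p_eq: "poly p z = z ^ l * poly q z" for z
    by (subst q(1)) (simp add: poly_power)
  have dp_eq: "z * poly (pderiv p) z = of_nat l * z ^ l * poly q z + z ^ l * z * poly (pderiv q) z" for z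
    by (subst q(1)) (cases l; simp add: pderiv_mult pderiv_power_Suc pderiv_pCons poly_power algebra_simps del: power_Suc; simp)
  have "((\<lambda>z. of_nat l + z * poly (pderiv q) z / poly q z) \<longlongrightarrow>
      of_nat l + 0 * poly (pderiv q) 0 / poly q 0) (at 0)"
    by (intro tendsto_intros q0)
  moreover have "eventually (\<lambda>z. poly q z \<noteq> 0) (at 0)"
    using q0 by (intro tendsto_imp_eventually_ne[of "poly q" "poly q 0"] tendsto_intros)
  then have "eventually (\<lambda>z. of_nat l + z * poly (pderiv q) z / poly q z = z * poly (pderiv p) z / poly p z) (at 0)"
    using eventually_neq_at_within[of 0 0 UNIV]
    by eventually_elim (unfold p_eq dp_eq, simp add: field_simps)
  ultimately show ?thesis by (simp add: tendsto_cong l_def)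
qed

text \<open>
  Integrating \<open>g'\<close> over the vertical segment from \<open>s\<close> to \<open>s + i \<theta>\<close>: if \<open>g'\<close> is close to the real
  number \<open>c\<close> on it, the imaginary part of \<open>g\<close> grows by about \<open>c \<theta>\<close>. Applied to a logarithm of
  \<open>p (e\<^sup>w)\<close>, this compares the argument of \<open>p\<close> on a ray with its argument on the positive axis.
\<close>

lemma vertical_increment_tendsto:
  fixes g g' :: "complex \<Rightarrow> complex" and F :: "real filter"
  assumes "\<theta> \<ge> 0"
    and deriv: "\<And>s t. 0 \<le> t \<Longrightarrow> t \<le> \<theta> \<Longrightarrow> (g has_field_derivative g' (Complex s t)) (at (Complex s t))"
    and lim: "\<And>\<epsilon>. \<epsilon> > 0 \<Longrightarrow> \<forall>\<^sub>F s in F. \<forall>t. norm (g' (Complex s t) - of_real c) \<le> \<epsilon>"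
  shows "((\<lambda>s. Im (g (Complex s \<theta>)) - Im (g (Complex s 0))) \<longlongrightarrow> c * \<theta>) F"
proof (rule tendstoI)
  fix e :: real assume "e > 0"
  define \<epsilon> where "\<epsilon> = e / (\<theta> + 1)"
  have eps: "\<epsilon> > 0" "\<epsilon> * \<theta> < e"
    using \<open>e > 0\<close> \<open>\<theta> \<ge> 0\<close> by (auto simp: \<epsilon>_def field_simps)
  show "\<forall>\<^sub>F s in F. dist (Im (g (Complex s \<theta>)) - Im (g (Complex s 0))) (c * \<theta>) < e"
    using lim[OF eps(1)]
  proof eventually_elim
    case (elim s)
    define L where "L = closed_segment (Complex s 0) (Complex s \<theta>)"
    have L: "\<exists>t. z = Complex s t \<and> 0 \<le> t \<and> t \<le> \<theta>" if "z \<in> L" for z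
    proof -
      have "Re z = s" "Im z \<in> closed_segment 0 \<theta>"
        using that unfolding L_def closed_segment_def
        by (auto simp: closed_segment_def algebra_simps Complex_eq)
      then show ?thesis using \<open>\<theta> \<ge> 0\<close> by (intro exI[of _ "Im z"]) (auto simp: closed_segment_eq_real_ivl complex_eq_iff)
    qed
    define h where "h z = g z - of_real c * z" for z
    have "norm (h (Complex s \<theta>) - h (Complex s 0)) \<le> \<epsilon> * norm (Complex s \<theta> - Complex s 0)"
    proof (rule field_differentiable_bound[where S = L and f' = "\<lambda>z. g' z - of_real c"])
      show "(h has_field_derivative g' z - of_real c) (at z within L)" if "z \<in> L" for z
        using L[OF that] unfolding h_def
        by (auto intro!: derivative_eq_intros has_field_derivative_at_within[OF deriv])
      show "norm (g' z - of_real c) \<le> \<epsilon>" if "z \<in> L" for z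
        using L[OF that] elim by auto
    qed (auto simp: L_def)
    also have "norm (Complex s \<theta> - Complex s 0) = \<theta>"
      using \<open>\<theta> \<ge> 0\<close> by (simp add: cmod_def)
    finally have "\<bar>Im (h (Complex s \<theta>) - h (Complex s 0))\<bar> \<le> \<epsilon> * \<theta>"
      using abs_Im_le_cmod order_trans by blast
    also have "Im (h (Complex s \<theta>) - h (Complex s 0)) = Im (g (Complex s \<theta>)) - Im (g (Complex s 0)) - c * \<theta>"
      by (simp add: h_def)
    finally show ?case using eps(2) by (simp add: dist_real_def)
  qed
qed

lemma uniformly_small_after_exp_at_top:
  assumes "(G \<longlongrightarrow> c) at_infinity" and "\<epsilon> > 0"
  shows "\<forall>\<^sub>F s in at_top. \<forall>t. norm (G (exp (Complex s t)) - c) \<le> \<epsilon>"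
proof -
  obtain b where b: "\<And>z. norm z \<ge> b \<Longrightarrow> dist (G z) c < \<epsilon>"
    using tendstoD[OF assms] by (auto simp: eventually_at_infinity)
  have "\<forall>\<^sub>F s :: real in at_top. b \<le> exp s"
    using exp_at_top by (simp only: filterlim_at_top)
  then show ?thesis
    by eventually_elim (auto intro!: less_imp_le[OF b[unfolded dist_norm]])
qed

lemma uniformly_small_after_exp_at_bot:
  assumes "(G \<longlongrightarrow> c) (at 0)" and "\<epsilon> > 0"
  shows "\<forall>\<^sub>F s in at_bot. \<forall>t. norm (G (exp (Complex s t)) - c) \<le> \<epsilon>"
proof -
  obtain d where d: "d > 0" "\<And>z. z \<noteq> 0 \<Longrightarrow> norm z < d \<Longrightarrow> dist (G z) c < \<epsilon>"
    using tendstoD[OF assms] by (auto simp: eventually_at)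
  have "\<forall>\<^sub>F s in at_bot. exp s < d"
    using order_tendstoD(2)[OF exp_at_bot d(1)] .
  then show ?thesis
    by eventually_elim (auto intro!: less_imp_le[OF d(2)[unfolded dist_norm]])
qed

lemma holomorphic_on_exp_poly: "(\<lambda>w. poly p (exp w)) holomorphic_on W"
  unfolding poly_altdef by (intro holomorphic_intros)

lemma poly_pos_on_positive_axis:
  fixes p :: "complex poly"
  assumes "p \<noteq> 0" and nonneg: "\<And>k. coeff p k \<in> \<real>\<^sub>\<ge>\<^sub>0" and "r > 0"
  obtains y where "y > 0" and "poly p (of_real r) = of_real y"
proof
  define y where "y = (\<Sum>k\<le>degree p. Re (coeff p k) * r ^ k)"
  have coeff: "coeff p k = of_real (Re (coeff p k))" "Re (coeff p k) \<ge> 0" for k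
    using nonneg[of k] by (auto elim!: nonneg_Reals_cases)
  have "poly p (of_real r) = (\<Sum>k\<le>degree p. of_real (Re (coeff p k)) * of_real r ^ k)"
    by (simp add: poly_altdef coeff(1)[symmetric])
  then show "poly p (of_real r) = of_real y" by (simp add: y_def)
  have "y \<ge> 0"
    unfolding y_def using coeff(2) \<open>r > 0\<close> by (intro sum_nonneg mult_nonneg_nonneg) auto
  moreover have "y \<noteq> 0"
  proof
    assume "y = 0"
    then have "Re (coeff p (degree p)) = 0"
      unfolding y_def using coeff(2) \<open>r > 0\<close>
      by (intro nonneg_coeffs_positive_root[where c = "\<lambda>k. Re (coeff p k)" and r = r and n = "degree p"]) auto
    then show False using coeff(1)[of "degree p"] \<open>p \<noteq> 0\<close> by simp
  qed
  ultimately show "y > 0" by simp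
qed

text \<open>
  In the coordinate \<open>w = log z\<close> the zero-free sector is a convex strip, so \<open>p (e\<^sup>w)\<close> has a holomorphic
  logarithm \<open>g\<close> on it. The argument on the ray of angle \<open>\<theta>\<close> is measured from the argument on the
  positive axis, where \<open>p\<close> is positive. This relative argument has the limits \<open>l \<theta>\<close> and \<open>n \<theta>\<close>,
  with \<open>l\<close> and \<open>n\<close> the lowest and highest exponents in \<open>p\<close>; zeros inside the sector would destroy
  this relation.
\<close>

lemma continuous_argument_on_ray:
  fixes p :: "complex poly" and \<phi> \<theta> :: real
  assumes "p \<noteq> 0" and nonneg: "\<And>k. coeff p k \<in> \<real>\<^sub>\<ge>\<^sub>0"
    and "0 < \<theta>" "\<theta> < \<phi>" "\<phi> \<le> pi"
    and nz: "\<And>z. z \<noteq> 0 \<Longrightarrow> \<bar>Arg z\<bar> < \<phi> \<Longrightarrow> poly p z \<noteq> 0"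
  obtains u :: "real \<Rightarrow> real"
  where "continuous_on UNIV u"
    and "(u \<longlongrightarrow> real (order 0 p) * \<theta>) at_bot" and "(u \<longlongrightarrow> real (degree p) * \<theta>) at_top"
    and "\<And>s. poly p (exp (Complex s \<theta>)) = of_real (norm (poly p (exp (Complex s \<theta>)))) * cis (u s)"
proof -
  define W where "W = {w. \<bar>Im w\<bar> < \<phi>}"
  have W_eq: "W = {w. Im w < \<phi>} \<inter> {w. Im w > - \<phi>}" by (auto simp: W_def)
  have "open W" unfolding W_eq by (intro open_Int open_halfspace_Im_lt open_halfspace_Im_gt)
  have "convex W" unfolding W_eq by (intro convex_Int convex_halfspace_Im_lt convex_halfspace_Im_gt)
  have inW: "Complex s t \<in> W" if "0 \<le> t" "t \<le> \<theta>" for s t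
    using that assms by (auto simp: W_def)
  have nzW: "poly p (exp w) \<noteq> 0" if "w \<in> W" for w
  proof (rule nz)
    have "\<bar>Im w\<bar> < pi" using that assms by (auto simp: W_def)
    then show "\<bar>Arg (exp w)\<bar> < \<phi>" using that by (subst Arg_exp) (auto simp: W_def)
  qed simp
  obtain g where g: "g holomorphic_on W" "\<And>w. w \<in> W \<Longrightarrow> poly p (exp w) = exp (g w)"
    using contractible_imp_holomorphic_log[of "\<lambda>w. poly p (exp w)" W]
    using \<open>convex W\<close> nzW convex_imp_contractible
    by (metis (no_types, lifting) holomorphic_on_exp_poly)
  define g' where "g' w = exp w * poly (pderiv p) (exp w) / poly p (exp w)" for w
  have deriv: "(g has_field_derivative g' w) (at w)" if "w \<in> W" for w
  proof -
    have dg: "(g has_field_derivative deriv g w) (at w)"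
      using g(1) \<open>open W\<close> that by (rule holomorphic_derivI)
    have "((\<lambda>w. exp (g w)) has_field_derivative exp (g w) * deriv g w) (at w)"
      using dg by (auto intro!: derivative_eq_intros)
    then have "((\<lambda>w. poly p (exp w)) has_field_derivative exp (g w) * deriv g w) (at w)"
      using that \<open>open W\<close> g(2)
      by (subst DERIV_cong_ev[OF refl _ refl]) (auto simp: eventually_nhds)
    moreover have "((\<lambda>w. poly p (exp w)) has_field_derivative poly (pderiv p) (exp w) * exp w) (at w)"
      by (auto intro!: derivative_eq_intros DERIV_chain'[OF _ poly_DERIV])
    ultimately have "exp (g w) * deriv g w = poly (pderiv p) (exp w) * exp w"
      by (rule DERIV_unique)
    then have "deriv g w = g' w"
      using g(2)[OF that] by (simp add: g'_def field_simps)
    with dg show ?thesis by simp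
  qed
  have polar: "poly p (exp w) = of_real (norm (poly p (exp w))) * cis (Im (g w))" if "w \<in> W" for w
    unfolding g(2)[OF that] norm_exp_eq_Re by (rule exp_eq_polar)
  define u where "u s = Im (g (Complex s \<theta>)) - Im (g (Complex s 0))" for s
  have cont: "continuous_on UNIV (\<lambda>s. g (Complex s t))" if "0 \<le> t" "t \<le> \<theta>" for t
  proof (rule continuous_on_compose2[OF holomorphic_on_imp_continuous_on[OF g(1)]])
    show "continuous_on UNIV (\<lambda>s. Complex s t)"
      unfolding Complex_eq by (intro continuous_intros)
  qed (use inW that in auto)
  show ?thesis
  proof (rule that[of u])
    show "continuous_on UNIV u"
      unfolding u_def using assms by (intro continuous_intros cont) auto
    have d: "(g has_field_derivative g' (Complex s t)) (at (Complex s t))" if "0 \<le> t" "t \<le> \<theta>" for s t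
      using deriv inW that by blast
    show "(u \<longlongrightarrow> real (order 0 p) * \<theta>) at_bot"
      unfolding u_def
      using uniformly_small_after_exp_at_bot[OF log_derivative_tendsto_order[OF assms(1)]] assms
      by (intro vertical_increment_tendsto[OF _ d]) (auto simp: g'_def)
    show "(u \<longlongrightarrow> real (degree p) * \<theta>) at_top"
      unfolding u_def
      using uniformly_small_after_exp_at_top[OF log_derivative_tendsto_degree[OF assms(1)]] assms
      by (intro vertical_increment_tendsto[OF _ d]) (auto simp: g'_def)
    fix s
    have "cis (Im (g (Complex s 0))) = 1"
    proof -
      let ?z = "exp (Complex s 0)"
      have "?z = of_real (exp s)" by (simp add: exp_eq_polar)
      then obtain y where y: "y > 0" "poly p ?z = of_real y"
        using poly_pos_on_positive_axis[OF \<open>p \<noteq> 0\<close> nonneg, of "exp s"] by auto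
      then have "of_real y = of_real y * cis (Im (g (Complex s 0)))"
        using polar[OF inW[of 0 s]] \<open>0 < \<theta>\<close> by simp
      then show ?thesis using y(1) by simp
    qed
    then have "cis (u s) = cis (Im (g (Complex s \<theta>)))"
      by (simp add: u_def cis_divide[symmetric])
    then show "poly p (exp (Complex s \<theta>)) = of_real (norm (poly p (exp (Complex s \<theta>)))) * cis (u s)"
      using polar[OF inW[of \<theta> s]] assms by simp
  qed
qed

section \<open>Critical points in a zero-free sector\<close>

lemma ivt_between_limits:
  fixes u :: "real \<Rightarrow> real"
  assumes "continuous_on UNIV u" and "(u \<longlongrightarrow> A) at_bot" and "(u \<longlongrightarrow> B) at_top"
    and "A < y" and "y < B"
  obtains s where "u s = y"
proof -
  obtain a where a: "\<And>s. s \<le> a \<Longrightarrow> u s < y"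
    using order_tendstoD(2)[OF assms(2,4)] by (auto simp: eventually_at_bot_linorder)
  obtain b where b: "\<And>s. s \<ge> b \<Longrightarrow> u s > y"
    using order_tendstoD(1)[OF assms(3,5)] by (auto simp: eventually_at_top_linorder)
  have "\<exists>s\<ge>min a b. s \<le> max a b \<and> u s = y"
    using a[of "min a b"] b[of "max a b"] assms(1)
    by (intro IVT') (auto intro: continuous_on_subset less_imp_le)
  then show ?thesis using that by blast
qed

lemma times_poly_pderiv:
  fixes p :: "'a::{idom, semiring_char_0} poly"
  shows "z * poly (pderiv p) z = (\<Sum>k\<le>degree p. of_nat k * coeff p k * z ^ k)"
proof -
  have "poly (pCons 0 (pderiv p)) z = (\<Sum>k\<le>degree p. coeff (pCons 0 (pderiv p)) k * z ^ k)"
  proof (cases "degree p = 0")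
    case True
    then have "pderiv p = 0" by (simp add: pderiv_eq_0_iff)
    then show ?thesis using True by simp
  next
    case False
    then have "degree (pCons 0 (pderiv p)) = degree p"
      by (simp add: degree_pCons_eq_if degree_pderiv pderiv_eq_0_iff)
    then show ?thesis using poly_altdef[of "pCons 0 (pderiv p)" z] by simp
  qed
  moreover have "coeff (pCons 0 (pderiv p)) k = of_nat k * coeff p k" for k
    by (cases k) (auto simp: coeff_pderiv)
  ultimately show ?thesis by simp
qed

text \<open>
  Restricted to a ray and projected to a line through the origin, a polynomial with real coefficients
  becomes a real polynomial in the radius whose coefficients are modulated by a sine.
\<close>

lemma Im_rotated_real_combination:
  fixes c :: "nat \<Rightarrow> real"
  shows "Im (cis (- \<xi>) * (\<Sum>k\<le>n. of_real (c k) * exp (Complex s \<theta>) ^ k)) =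
    (\<Sum>k\<le>n. c k * sin (real k * \<theta> - \<xi>) * exp s ^ k)"
proof -
  have rot: "cis (- \<xi>) * (of_real (c k) * exp (Complex s \<theta>) ^ k) =
      of_real (c k * exp s ^ k) * cis (real k * \<theta> - \<xi>)" for k
  proof -
    have "exp (Complex s \<theta>) ^ k = of_real (exp s ^ k) * cis (real k * \<theta>)"
      by (simp add: exp_eq_polar power_mult_distrib Complex.DeMoivre)
    then show ?thesis by (simp add: cis_mult)
  qed
  show ?thesis
    unfolding sum_distrib_left rot Im_sum by (intro sum.cong refl) simp
qed

text \<open>
  Let \<open>u\<close> be the continuous argument of \<open>p\<close> on the ray as a function of the logarithm \<open>s\<close> of the radius,
  running from \<open>l \<theta>\<close> to \<open>n \<theta>\<close>, and suppose that \<open>p'\<close> vanishes at the point \<open>z\<^sub>0\<close> with parameter \<open>s\<^sub>0\<close>.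
  The component of \<open>p\<close> perpendicular to the direction \<open>p(z\<^sub>0)\<close> is a real polynomial in the radius. It
  has a double zero at \<open>e\<^sup>s\<close> for \<open>s = s\<^sub>0\<close>, and it vanishes whenever \<open>u\<close> takes one of the levels congruent
  to \<open>u(s\<^sub>0)\<close> modulo \<open>\<pi>\<close>. The levels
  strictly between \<open>l \<theta>\<close> and \<open>n \<theta>\<close> are all taken, and their number is the bound that
  Descartes' rule gives for the zeros with multiplicity.
\<close>

lemma pderiv_nonzero_on_ray:
  fixes p :: "complex poly" and \<phi> \<theta> s\<^sub>0 :: real
  assumes "degree p > 0" and nonneg: "\<And>k. coeff p k \<in> \<real>\<^sub>\<ge>\<^sub>0"
    and \<theta>: "0 < \<theta>" "\<theta> < \<phi>" "\<phi> \<le> pi"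
    and nz: "\<And>z. z \<noteq> 0 \<Longrightarrow> \<bar>Arg z\<bar> < \<phi> \<Longrightarrow> poly p z \<noteq> 0"
  shows "poly (pderiv p) (exp (Complex s\<^sub>0 \<theta>)) \<noteq> 0"
proof
  assume crit: "poly (pderiv p) (exp (Complex s\<^sub>0 \<theta>)) = 0"
  define n where "n = degree p"
  define l where "l = order 0 p"
  define a where "a k = Re (coeff p k)" for k
  have coeff: "coeff p k = of_real (a k)" and a_nonneg: "a k \<ge> 0" for k
    using nonneg[of k] by (auto simp: a_def elim!: nonneg_Reals_cases)
  have "p \<noteq> 0" using assms(1) by auto
  have low: "a k = 0" if "k < l" for k
    using monom_1_dvd_iff[OF \<open>p \<noteq> 0\<close>, of l] that by (simp add: monom_1_dvd_iff' l_def a_def)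
  have pz: "poly p z = (\<Sum>k\<le>n. of_real (a k) * z ^ k)" for z
    by (simp add: poly_altdef n_def coeff)
  have dpz: "z * poly (pderiv p) z = (\<Sum>k\<le>n. of_real (real k * a k) * z ^ k)" for z
    unfolding times_poly_pderiv n_def by (simp add: coeff)
  have "l \<le> n" using order_degree[OF \<open>p \<noteq> 0\<close>] by (simp add: l_def n_def)
  show False
  proof (cases "l = n")
    case True
    let ?z = "exp (Complex s\<^sub>0 \<theta>)"
    have "?z * poly (pderiv p) ?z = (\<Sum>k\<in>{n}. of_real (real k * a k) * ?z ^ k)"
      unfolding dpz using low True by (intro sum.mono_neutral_right) auto
    moreover have "a n \<noteq> 0" using \<open>p \<noteq> 0\<close> coeff[of n] by (auto simp: n_def)
    ultimately show False using crit assms(1) by (simp add: n_def)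
  next
    case False
    then have "real l * \<theta> < real n * \<theta>" using \<open>l \<le> n\<close> \<theta> by simp
    obtain u where u: "continuous_on UNIV u" "(u \<longlongrightarrow> real l * \<theta>) at_bot" "(u \<longlongrightarrow> real n * \<theta>) at_top"
      "\<And>s. poly p (exp (Complex s \<theta>)) = of_real (norm (poly p (exp (Complex s \<theta>)))) * cis (u s)"
      using continuous_argument_on_ray[OF \<open>p \<noteq> 0\<close> nonneg \<theta> nz] unfolding l_def n_def by blast
    \<comment> \<open>\<open>\<xi>\<close> is the first level above \<open>l \<theta>\<close> that is congruent to \<open>u s\<^sub>0\<close> modulo \<open>\<pi>\<close>, and \<open>M\<close> is the number
      of such levels strictly between \<open>l \<theta>\<close> and \<open>n \<theta>\<close>.\<close>
    define i where "i = \<lfloor>(real l * \<theta> - u s\<^sub>0) / pi\<rfloor> + 1"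
    define \<xi> where "\<xi> = u s\<^sub>0 + pi * of_int i"
    have \<xi>: "\<xi> - pi \<le> real l * \<theta>" "real l * \<theta> < \<xi>"
    proof -
      have "of_int i - 1 \<le> (real l * \<theta> - u s\<^sub>0) / pi" "(real l * \<theta> - u s\<^sub>0) / pi < of_int i"
        unfolding i_def by linarith+
      then show "\<xi> - pi \<le> real l * \<theta>" "real l * \<theta> < \<xi>"
        unfolding \<xi>_def by (simp_all add: field_simps)
    qed
    define M where "M = (LEAST M. real n * \<theta> \<le> \<xi> + pi * real M)"
    have "\<exists>M. real n * \<theta> \<le> \<xi> + pi * real M"
    proof -
      obtain M where "(real n * \<theta> - \<xi>) / pi < real M" using reals_Archimedean2 by blast
      then show ?thesis by (intro exI[of _ M]) (simp add: field_simps)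
    qed
    then have M: "real n * \<theta> \<le> \<xi> + pi * real M" unfolding M_def by (rule LeastI_ex)
    have below: "\<xi> + pi * real j < real n * \<theta>" if "j < M" for j
      using not_less_Least[of j] that unfolding M_def by (meson not_le)
    have "\<exists>s. u s = \<xi> + pi * real j" if "j < M" for j
    proof -
      have "real l * \<theta> < \<xi> + pi * real j" using \<xi>(2) by (rule less_le_trans) simp
      then show ?thesis using ivt_between_limits[OF u(1-3) _ below[OF that]] by metis
    qed
    then obtain \<sigma> where \<sigma>: "\<And>j. j < M \<Longrightarrow> u (\<sigma> j) = \<xi> + pi * real j" by metis
    have F: "(\<Sum>k\<le>n. a k * sin (real k * \<theta> - \<xi>) * exp s ^ k) =
        norm (poly p (exp (Complex s \<theta>))) * sin (u s - \<xi>)" for s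
    proof -
      have "(\<Sum>k\<le>n. a k * sin (real k * \<theta> - \<xi>) * exp s ^ k) = Im (cis (- \<xi>) * poly p (exp (Complex s \<theta>)))"
        unfolding pz by (rule Im_rotated_real_combination[symmetric])
      also have "cis (- \<xi>) * poly p (exp (Complex s \<theta>)) =
          of_real (norm (poly p (exp (Complex s \<theta>)))) * cis (u s - \<xi>)"
        by (subst u(4)) (simp add: cis_mult)
      finally show ?thesis by simp
    qed
    define S where "S = insert (exp s\<^sub>0) ((\<lambda>j. exp (\<sigma> j)) ` {..<M})"
    have sin_r\<^sub>0: "sin (u s\<^sub>0 - \<xi>) = 0"
      unfolding \<xi>_def sin_zero_iff_int2 by (intro exI[of _ "- i"]) simp
    have sin_\<sigma>: "sin (u (\<sigma> j) - \<xi>) = 0" if "j < M" for j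
      using \<sigma>[OF that] by (simp add: mult.commute)
    have roots: "(\<Sum>k\<le>n. a k * sin (real k * \<theta> - \<xi>) * x ^ k) = 0" if x: "x \<in> S" for x
    proof -
      consider "x = exp s\<^sub>0" | j where "j < M" "x = exp (\<sigma> j)"
        using x unfolding S_def by auto
      then show ?thesis
      proof cases
        case 1
        show ?thesis unfolding 1 F sin_r\<^sub>0 by simp
      next
        case (2 j)
        show ?thesis unfolding 2(2) F sin_\<sigma>[OF 2(1)] by simp
      qed
    qed
    have "inj_on (\<lambda>j. exp (\<sigma> j)) {..<M}"
    proof (rule inj_onI)
      fix j k assume jk: "j \<in> {..<M}" "k \<in> {..<M}" "exp (\<sigma> j) = exp (\<sigma> k)"
      have "u (\<sigma> j) = \<xi> + pi * real j" "u (\<sigma> k) = \<xi> + pi * real k"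
        using \<sigma> jk(1,2) by blast+
      moreover have "u (\<sigma> j) = u (\<sigma> k)"
        using jk(3) by (metis exp_inj_iff)
      ultimately have "pi * real j = pi * real k" by linarith
      then show "j = k" by simp
    qed
    then have "card ((\<lambda>j. exp (\<sigma> j)) ` {..<M}) = M" by (simp add: card_image)
    then have "card S \<ge> M"
      unfolding S_def by (metis card_insert_le)
    have double: "(\<Sum>k\<le>n. real k * (a k * sin (real k * \<theta> - \<xi>)) * exp s\<^sub>0 ^ k) = 0"
      using Im_rotated_real_combination[where \<xi> = \<xi> and c = "\<lambda>k. real k * a k" and n = n and s = s\<^sub>0 and \<theta> = \<theta>]
      unfolding dpz[symmetric] crit by (simp add: mult.assoc)
    have range: "real k * \<theta> - \<xi> \<in> {- pi .. pi * real M}" if "k \<le> n" "a k \<noteq> 0" for k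
    proof -
      have "real l * \<theta> \<le> real k * \<theta>" "real k * \<theta> \<le> real n * \<theta>"
        using low[of k] that \<theta>(1) by (auto simp: not_less[symmetric])
      then show ?thesis using \<xi>(1) M by auto
    qed
    have vanish: "a k * sin (real k * \<theta> - \<xi>) = 0" if "k \<le> n" for k
      using a_nonneg \<theta>(1) range _ \<open>card S \<ge> M\<close> _ _ roots double that
      by (rule descartes_sine_coefficients) (auto simp: S_def)
    \<comment> \<open>By Descartes' rule the perpendicular component is identically zero, although \<open>u\<close> also takes a value strictly between the levels
      \<open>\<xi> - \<pi>\<close> and \<open>\<xi>\<close>, where it cannot vanish.\<close>
    obtain y where y: "real l * \<theta> < y" "y < min \<xi> (real n * \<theta>)"
      using dense[of "real l * \<theta>" "min \<xi> (real n * \<theta>)"] \<xi>(2) \<open>real l * \<theta> < real n * \<theta>\<close> by auto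
    then obtain s where s: "u s = y"
      using ivt_between_limits[OF u(1-3), of y] by auto
    have "sin (\<xi> - u s) > 0"
      by (rule sin_gt_zero) (use s y \<xi>(1) in auto)
    then have "sin (u s - \<xi>) \<noteq> 0"
      by (metis minus_diff_eq sin_minus neg_0_less_iff_less less_irrefl neg_equal_0_iff_equal)
    moreover have "poly p (exp (Complex s \<theta>)) \<noteq> 0"
    proof (rule nz)
      show "\<bar>Arg (exp (Complex s \<theta>))\<bar> < \<phi>" using \<theta> by (subst Arg_exp) auto
    qed simp
    ultimately show False using F[of s] vanish by simp
  qed
qed

theorem theorem1:
  fixes \<phi> :: real and n :: nat and p :: "complex poly"
  assumes "\<phi> \<in> {0..pi}" and "n \<ge> 2"
    and "p \<in> nonneg_polys_sector n \<phi>"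
  shows "pderiv p \<in> nonneg_polys_sector (n - 1) \<phi>"
proof -
  have deg: "degree p = n" and nonneg: "\<And>k. coeff p k \<in> \<real>\<^sub>\<ge>\<^sub>0"
    and zeros: "\<And>z. poly p z = 0 \<Longrightarrow> z \<in> sector \<phi>"
    using assms(3) by (auto simp: nonneg_polys_sector_def nonneg_polys_def)
  have nz: "poly p z \<noteq> 0" if "z \<noteq> 0" "\<bar>Arg z\<bar> < \<phi>" for z
    using zeros[of z] that by (auto simp: sector_def)
  have nonneg': "coeff (pderiv p) k \<in> \<real>\<^sub>\<ge>\<^sub>0" for k
    unfolding coeff_pderiv using nonneg by (intro nonneg_Reals_mult_I) auto
  have "z \<in> sector \<phi>" if root: "poly (pderiv p) z = 0" for z
  proof (rule ccontr)
    assume "z \<notin> sector \<phi>"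
    then have z: "z \<noteq> 0" "\<bar>Arg z\<bar> < \<phi>" by (auto simp: sector_def)
    have upper: False if "poly (pderiv p) w = 0" "w \<noteq> 0" "0 < Arg w" "Arg w < \<phi>" for w
    proof -
      have "exp (Complex (ln (norm w)) (Arg w)) = rcis (norm w) (Arg w)"
        using \<open>w \<noteq> 0\<close> by (simp add: exp_eq_polar rcis_def)
      then have "exp (Complex (ln (norm w)) (Arg w)) = w"
        by (simp add: rcis_cmod_Arg)
      moreover have "poly (pderiv p) (exp (Complex (ln (norm w)) (Arg w))) \<noteq> 0"
        by (rule pderiv_nonzero_on_ray[OF _ nonneg that(3,4) _ nz]) (use deg assms(1,2) in auto)
      ultimately show False using that(1) by simp
    qed
    consider "Arg z > 0" | "Arg z = 0" | "Arg z < 0" by linarith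
    then show False
    proof cases
      case 1
      then show False using upper[of z] root z by auto
    next
      case 2
      define r where "r = norm z"
      have r: "z = of_real r" "r > 0"
        using rcis_cmod_Arg[of z] z(1) unfolding 2 r_def by (simp_all add: rcis_def)
      have "pderiv p \<noteq> 0" using deg assms(2) by (simp add: pderiv_eq_0_iff)
      then obtain y where "y > 0" "poly (pderiv p) (of_real r) = of_real y"
        using poly_pos_on_positive_axis[OF _ nonneg' r(2)] by blast
      then show False using root r(1) by simp
    next
      case 3
      have "poly (pderiv p) (cnj z) = 0"
        using root real_poly_cnj_root_iff[OF subsetD[OF nonneg_Reals_subset_Reals nonneg'], of z] by simp
      moreover have "z \<notin> \<real>" using 3 by (auto elim!: Reals_cases simp: Arg_of_real split: if_splits)
      then have "Arg (cnj z) = - Arg z" by (simp add: Arg_cnj)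
      ultimately show False using upper[of "cnj z"] z 3 by auto
    qed
  qed
  moreover have "degree (pderiv p) = n - 1" using deg by (simp add: degree_pderiv)
  ultimately show ?thesis
    using nonneg' by (simp add: nonneg_polys_sector_def nonneg_polys_def)
qed

end
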